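(* Let $p$ be an odd prime and suppose that $x,y,z$ are positive integers with $|x-y|=1$ and $$p^x+(2p+1)^y=z^2.$$ Then exactly one of the following holds. (i) $(x,y,z)=(2,1,p+1)$. (ii) The integer $2p+1$ is composite, and there exist integers $k\ge 2$, $a\ge 1$ and $b\ge 0$ with $x=2a$ and $y=2b+1$ such that $p=2k^2-1$, $2p+1=(2k-1)(2k+1)$ with $\gcd(2k-1,2k+1)=1$, $$(2k+1)^{2b+1}-(2k-1)^{2b+1}=2(2k^2-1)^a,$$ and $(2b+1)2^b<2k^2-1$; consequently $b<\lceil \log_2(2k^2-1)\rceil$. *)

theory Defs
  imports Complex_Main "HOL-Computational_Algebra.Primes"
begin

definition composite :: "nat \<Rightarrow> bool" where
  "composite n \<longleftrightarrow> n > 1 \<and> \<not> prime n"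

end

theory Submission
  imports Defs "HOL-Computational_Algebra.Nth_Powers"
begin

text \<open>
  One of \<open>x\<close>, \<open>y\<close> is even, so one summand is a square \<open>w\<^sup>2\<close> and the other one factors as
  \<open>(z - w) (z + w)\<close> with coprime factors.

  If \<open>y = 2 b\<close>, the factors of \<open>p\<^sup>x\<close> are \<open>1\<close> and \<open>p\<^sup>x\<close>, so \<open>2 (2 p + 1)\<^sup>b + 1 = p\<^sup>x\<close>. Reduction
  modulo \<open>p\<close> gives \<open>p = 3\<close>, and then reduction modulo \<open>7\<close> contradicts \<open>x\<close> being odd.

  If \<open>x = 2 a\<close> and \<open>y = 2 b + 1\<close>, the factors are \<open>r\<^sup>y\<close> and \<open>s\<^sup>y\<close> with \<open>r s = 2 p + 1\<close> and
  \<open>s\<^sup>y - r\<^sup>y = 2 p\<^sup>a\<close>. Here \<open>s - r\<close> is even and divides \<open>2 p\<^sup>a\<close>, so it is \<open>2 p\<^sup>j\<close>. For \<open>j > 0\<close> the size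
  of \<open>s\<close> forces \<open>r = 1\<close> and then the first case; \<open>j = 0\<close> gives \<open>r = 2 k - 1\<close>, \<open>s = 2 k + 1\<close>.
  The bound on \<open>b\<close> comes from the top term of the binomial expansion of \<open>(2 k + 1)\<^sup>y - (2 k - 1)\<^sup>y\<close>,
  because \<open>(2 k)\<^sup>2 = 2 (p + 1)\<close> and \<open>a \<le> b + 1\<close>.
\<close>

text \<open>The right-hand sides are the leading terms of binomial expansions with nonnegative
  terms. The sum is bounded along with the difference because multiplying the powers by
  \<open>m\<^sup>2 + 1 + 2 * m\<close> and \<open>m\<^sup>2 + 1 - 2 * m\<close> mixes the two in the
  induction step.\<close>

lemma odd_power_diff_and_sum_ge:
  fixes m :: int
  assumes "m \<ge> 1"
  shows "(m + 1) ^ (2 * b + 1) - (m - 1) ^ (2 * b + 1) \<ge> 2 * (2 * int b + 1) * m ^ (2 * b)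
       \<and> (m + 1) ^ (2 * b + 1) + (m - 1) ^ (2 * b + 1) \<ge> 2 * m ^ (2 * b + 1)"
proof (induction b)
  case 0
  show ?case by simp
next
  case (Suc b)
  define u where "u = (m + 1) ^ (2 * b + 1)"
  define v where "v = (m - 1) ^ (2 * b + 1)"
  define q where "q = m ^ (2 * b)"
  have u': "(m + 1) ^ (2 * Suc b + 1) = u * (m\<^sup>2 + 1 + 2 * m)"
    by (simp add: u_def power2_eq_square algebra_simps)
  have v': "(m - 1) ^ (2 * Suc b + 1) = v * (m\<^sup>2 + 1 - 2 * m)"
    by (simp add: v_def power2_eq_square algebra_simps)
  have q': "m ^ (2 * Suc b) = q * m\<^sup>2" "m ^ (2 * Suc b + 1) = q * m\<^sup>2 * m"
    by (simp_all add: q_def power2_eq_square)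
  have d: "u - v \<ge> 2 * (2 * int b + 1) * q" and s: "u + v \<ge> 2 * (q * m)"
    using Suc by (simp_all add: u_def v_def q_def mult.commute)
  have "q \<ge> 0" using assms by (simp add: q_def)
  then have "2 * (2 * int b + 1) * q \<ge> 0" by simp
  with d have "u - v \<ge> 0" by linarith
  have "q * m \<ge> 0" using \<open>q \<ge> 0\<close> assms by simp
  with s have "u + v \<ge> 0" by linarith
  have d1: "(u - v) * m\<^sup>2 \<ge> 2 * (2 * int b + 1) * q * m\<^sup>2"
    using d by (rule mult_right_mono) simp
  have s1: "(u + v) * m \<ge> 2 * (q * m) * m"
    using s assms by (intro mult_right_mono) auto
  have s2: "(u + v) * m\<^sup>2 \<ge> 2 * (q * m) * m\<^sup>2"
    using s by (rule mult_right_mono) simp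
  have d2: "(u - v) * m \<ge> 0"
    using \<open>u - v \<ge> 0\<close> assms by simp
  have "u * (m\<^sup>2 + 1 + 2 * m) - v * (m\<^sup>2 + 1 - 2 * m) = (u - v) * m\<^sup>2 + (u - v) + 2 * ((u + v) * m)"
    by (simp add: algebra_simps)
  also have "\<dots> \<ge> 2 * (2 * int b + 1) * q * m\<^sup>2 + 2 * (2 * (q * m) * m)"
    using d1 s1 \<open>u - v \<ge> 0\<close> by linarith
  also have "2 * (2 * int b + 1) * q * m\<^sup>2 + 2 * (2 * (q * m) * m)
      = 2 * (2 * int (Suc b) + 1) * (q * m\<^sup>2)"
    by (simp add: power2_eq_square algebra_simps)
  finally have 1: "2 * (2 * int (Suc b) + 1) * (q * m\<^sup>2) \<le> u * (m\<^sup>2 + 1 + 2 * m) - v * (m\<^sup>2 + 1 - 2 * m)" .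
  have "u * (m\<^sup>2 + 1 + 2 * m) + v * (m\<^sup>2 + 1 - 2 * m) = (u + v) * m\<^sup>2 + (u + v) + 2 * ((u - v) * m)"
    by (simp add: algebra_simps)
  also have "\<dots> \<ge> 2 * (q * m) * m\<^sup>2"
    using s2 d2 \<open>u + v \<ge> 0\<close> by linarith
  finally have 2: "2 * (q * m\<^sup>2 * m) \<le> u * (m\<^sup>2 + 1 + 2 * m) + v * (m\<^sup>2 + 1 - 2 * m)"
    by (simp add: algebra_simps)
  show ?case unfolding u' v' q' using 1 2 by blast
qed

lemma mult_eq_power_coprimeE:
  fixes u v c :: nat
  assumes "coprime u v" "u * v = c ^ n" "u > 0" "v > 0" "n > 0"
  obtains r s where "u = r ^ n" "v = s ^ n" "r * s = c"
proof -
  have "is_nth_power n (u * v)"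
    unfolding assms(2) by (rule is_nth_power_nth_power)
  then obtain r s where "u = r ^ n" "v = s ^ n"
    using is_nth_power_mult_coprime_natD[OF assms(1) _ assms(3,4)] by (metis is_nth_powerE)
  moreover from this have "(r * s) ^ n = c ^ n"
    using assms(2) by (simp add: power_mult_distrib)
  then have "r * s = c"
    using assms(5) by (simp add: power_eq_iff_eq_base)
  ultimately show thesis using that by blast
qed

text \<open>With \<open>u\<close> for \<open>z - w\<close>, the product
  \<open>(z - w) * (z + w)\<close> needs no truncated subtraction.\<close>

lemma square_diff_factor_nat:
  fixes n w z :: nat
  assumes "w\<^sup>2 + n = z\<^sup>2" "n > 0"
  obtains u where "z = w + u" "u > 0" "u * (u + 2 * w) = n"
proof -
  have "w\<^sup>2 < z\<^sup>2" using assms by linarith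
  then have "w < z" by (rule power_less_imp_less_base) simp
  then obtain u where u: "z = w + u" "u > 0" by (metis less_imp_add_positive)
  moreover have "u * (u + 2 * w) = n"
    using assms u by (simp add: power2_eq_square algebra_simps)
  ultimately show thesis using that by blast
qed

lemma coprime_double_plus_one: "coprime p (2 * p + 1)" for p :: nat
proof (rule coprimeI)
  fix c
  assume "c dvd p" "c dvd 2 * p + 1"
  then show "is_unit c" by (meson dvd_add_right_iff dvd_mult)
qed

lemma no_solution_y_even:
  fixes p x b z :: nat
  assumes "prime p" "odd p" "odd x" "b > 0" and eq: "p ^ x + (2 * p + 1) ^ (2 * b) = z\<^sup>2"
  shows False
proof -
  define w where "w = (2 * p + 1) ^ b"
  have "p > 0" using assms(1) by (simp add: prime_gt_0_nat)
  have "w\<^sup>2 + p ^ x = z\<^sup>2"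
    using eq by (simp add: w_def power_mult [symmetric] mult.commute add.commute)
  then obtain u where u: "u > 0" "u * (u + 2 * w) = p ^ x"
    using square_diff_factor_nat \<open>p > 0\<close> by (metis zero_less_power)
  then obtain i j where ij: "u = p ^ i" "u + 2 * w = p ^ j"
    using prime_power_mult_nat[OF assms(1)] by metis
  have "w > 0" by (simp add: w_def)
  then have "j > 0" using ij u(1) by (cases j) auto
  have cop: "coprime p (2 * p + 1)" by (rule coprime_double_plus_one)
  \<comment> \<open>Otherwise \<open>p\<close> divides both factors, hence their difference
    \<open>2 * w\<close>, which is coprime to \<open>p\<close>.\<close>
  have "i = 0"
  proof (rule ccontr)
    assume "i \<noteq> 0"
    then have "p dvd u" "p dvd u + 2 * w"
      using ij \<open>j > 0\<close> by simp_all
    then have "p dvd 2 * w" by (simp add: dvd_add_right_iff)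
    moreover have "coprime p (2 * w)"
      using cop assms(2) by (simp add: w_def coprime_right_2_iff_odd)
    ultimately show False
      using assms(1) by (metis coprime_absorb_left not_prime_unit)
  qed
  with ij u have main: "2 * w + 1 = p ^ x" by simp
  have "x > 0" using assms(3) by (cases x) auto
  \<comment> \<open>Modulo \<open>p\<close>, \<open>w\<close> is 1, so
    \<open>2 * w + 1 = p ^ x\<close> reduces to 3 = 0.\<close>
  have "w mod p = ((2 * p + 1) mod p) ^ b mod p" by (simp add: w_def power_mod)
  also have "(2 * p + 1) mod p = 1 mod p" by (rule mod_mult_self3)
  also have "(1 mod p) ^ b mod p = 1 mod p" by (simp only: power_mod power_one)
  finally have "(2 * w + 1) mod p = 3 mod p"
    by (metis mod_mult_right_eq mod_add_left_eq mult_1_right numeral_plus_one semiring_norm(5))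
  then have "p dvd 3"
    using main \<open>x > 0\<close> by (simp add: mod_eq_0_iff_dvd)
  then have "p \<le> 3" by (rule dvd_imp_le) simp
  moreover have "p > 1" using assms(1) by (rule prime_gt_1_nat)
  moreover have "p \<noteq> 2" using assms(2) by auto
  ultimately have p3: "p = 3" by linarith
  obtain c where c: "x = 2 * c + 1" using assms(3) by (rule oddE)
  have "7 dvd w" using assms(4) by (simp add: w_def p3)
  then have "(2 * w + 1) mod 7 = 1" by presburger
  then have "3 ^ (2 * c + 1) mod 7 = (1 :: nat)"
    using main by (simp add: p3 c)
  \<comment> \<open>Multiplication by 9, that is by 2 modulo 7, permutes the residues 3, 6, 5
    cyclically, so odd powers of 3 are never 1.\<close>
  moreover have "3 ^ (2 * c + 1) mod 7 \<in> {3, 5, 6 :: nat}"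
  proof (induction c)
    case (Suc c)
    have "3 ^ (2 * Suc c + 1) mod 7 = 9 * (3 ^ (2 * c + 1) mod 7) mod (7 :: nat)"
      by (simp add: mod_mult_right_eq)
    then show ?case using Suc by auto
  qed simp
  ultimately show False by simp
qed

lemma solution_x_even:
  fixes p a b z :: nat
  assumes p: "prime p" "odd p" and ab: "a \<ge> 1" "a \<le> b + 1"
    and eq: "p ^ (2 * a) + (2 * p + 1) ^ (2 * b + 1) = z\<^sup>2"
  obtains "a = 1" "b = 0" "z = p + 1"
    | k :: nat where "k \<ge> 2" "p + 1 = 2 * k\<^sup>2"
        "(2 * k + 1) ^ (2 * b + 1) = (2 * k - 1) ^ (2 * b + 1) + 2 * p ^ a"
proof -
  define n where "n = 2 * b + 1"
  have "p > 2" using p prime_gt_1_nat[of p] by (cases "p = 2") auto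
  have "(p ^ a)\<^sup>2 + (2 * p + 1) ^ n = z\<^sup>2"
    using eq by (simp add: n_def power_mult [symmetric] mult.commute)
  then obtain u where z: "z = p ^ a + u" and "u > 0"
    and u: "u * (u + 2 * p ^ a) = (2 * p + 1) ^ n"
    using square_diff_factor_nat by (metis zero_less_power zero_less_Suc Suc_eq_plus1)
  \<comment> \<open>\<open>u\<close> divides a power of \<open>2 * p + 1\<close>, which is odd and
    coprime to \<open>p\<close>.\<close>
  have "coprime u (2 * p ^ a)"
  proof -
    have "coprime (2 * p + 1) p"
      using coprime_double_plus_one by (rule coprime_imp_coprime) auto
    then have "coprime ((2 * p + 1) ^ n) (2 * p ^ a)"
      by simp
    then show ?thesis using u by (metis coprime_mult_left_iff)
  qed
  then have "coprime u (u + 2 * p ^ a)"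
    by (simp add: coprime_iff_gcd_eq_1)
  then obtain r s where rs: "u = r ^ n" "u + 2 * p ^ a = s ^ n" "r * s = 2 * p + 1"
    using mult_eq_power_coprimeE[OF _ u] \<open>u > 0\<close> n_def by (metis add_gr_0 zero_less_one)
  have "p ^ a > 0" using \<open>p > 2\<close> by simp
  have "r ^ n < s ^ n" using rs \<open>p ^ a > 0\<close> by linarith
  then have "r < s" by (rule power_less_imp_less_base) simp
  have "odd (r * s)" unfolding rs(3) by simp
  then have "odd r" "odd s" by simp_all
  then have "even (s - r)" by simp
  then obtain d where "s - r = 2 * d" by (rule evenE)
  then have d: "s = r + 2 * d" "d > 0" using \<open>r < s\<close> by linarith+
  have "int s - int r dvd int s ^ n - int r ^ n"
    by (metis power_diff_sumr2 dvd_triv_left)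
  moreover have "int s ^ n - int r ^ n = int (2 * p ^ a)"
    using rs by (metis add_diff_cancel_left' of_nat_add of_nat_power)
  moreover have "int s - int r = int (2 * d)" using d by simp
  ultimately have "2 * d dvd 2 * p ^ a" by (metis int_dvd_int_iff)
  then have "d dvd p ^ a" by simp
  then obtain j where j: "d = p ^ j" using p(1) by (auto simp: divides_primepow_nat)
  show thesis
  proof (cases "j = 0")
    \<comment> \<open>Now \<open>s \<ge> r + 2 * p\<close>, so \<open>r \<ge> 2\<close> would make
      \<open>r * s\<close> exceed \<open>2 * p + 1\<close>.\<close>
    case False
    then have "p \<le> d" using j \<open>p > 2\<close> by (simp add: self_le_power)
    have "r > 0" using \<open>odd r\<close> by (cases r) auto
    have "r = 1"
    proof (rule ccontr)
      assume "r \<noteq> 1"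
      then have "r \<ge> 2" using \<open>r > 0\<close> by linarith
      then have "2 * s \<le> r * s" by simp
      with rs(3) d \<open>p \<le> d\<close> \<open>r > 0\<close> show False by linarith
    qed
    with rs have "s = 2 * p + 1" "u = 1" by simp_all
    with rs have e: "(2 * p + 1) ^ n = 2 * p ^ a + 1" by simp
    \<comment> \<open>For \<open>a \<ge> 2\<close> the right side of \<open>e\<close> is below
      \<open>4 * p ^ a \<le> (2 * p) ^ a\<close>, while \<open>a \<le> b + 1 \<le> n\<close> makes
      the left side at least \<open>(2 * p + 1) ^ a\<close>.\<close>
    have "a = 1"
    proof (rule ccontr)
      assume "a \<noteq> 1"
      then obtain c where c: "a = Suc (Suc c)" using ab(1)
        by (metis One_nat_def Suc_le_D old.nat.exhaust)
      have "2 * p ^ a + 1 < 4 * p ^ a" using \<open>p ^ a > 0\<close> by linarith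
      also have "4 * p ^ a \<le> 2 ^ a * p ^ a" by (simp add: c)
      also have "\<dots> = (2 * p) ^ a" by (simp add: power_mult_distrib)
      also have "\<dots> \<le> (2 * p + 1) ^ a" by (rule power_mono) simp_all
      also have "\<dots> \<le> (2 * p + 1) ^ n" using ab by (intro power_increasing) (auto simp: n_def)
      finally show False using e by simp
    qed
    with e have "(2 * p + 1) ^ n = (2 * p + 1) ^ 1" by simp
    then have "n = 1" using \<open>p > 2\<close> by (subst (asm) power_inject_exp) auto
    then show thesis using that(1) \<open>a = 1\<close> z \<open>u = 1\<close> by (simp add: n_def)
  next
    case True
    then have s: "s = r + 2" using j d by simp
    obtain c where c: "r = 2 * c + 1" using \<open>odd r\<close> by (rule oddE)
    \<comment> \<open>\<open>2 * k\<close> is the midpoint of \<open>r\<close> and \<open>s\<close>,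
      so \<open>r * s = 4 * k\<^sup>2 - 1\<close>, which yields
      \<open>p + 1 = 2 * k\<^sup>2\<close>.\<close>
    define k where "k = c + 1"
    have k: "r = 2 * k - 1" "s = 2 * k + 1" by (simp_all add: k_def c s)
    have pk: "p + 1 = 2 * k\<^sup>2"
      using rs(3) by (simp add: k_def c s power2_eq_square algebra_simps)
    have "k \<ge> 2"
    proof (rule ccontr)
      assume "\<not> k \<ge> 2"
      then have "k = 1" by (simp add: k_def)
      with pk \<open>p > 2\<close> show False by simp
    qed
    moreover have "(2 * k + 1) ^ (2 * b + 1) = (2 * k - 1) ^ (2 * b + 1) + 2 * p ^ a"
      using rs(1,2) by (simp only: k n_def)
    ultimately show thesis using that(2) pk by blast
  qed
qed

lemma exponent_bound:
  fixes k p :: int and a b :: nat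
  assumes "k \<ge> 1" "p = 2 * k\<^sup>2 - 1" "p > 1" "a \<le> b + 1"
    and eq: "(2 * k + 1) ^ (2 * b + 1) - (2 * k - 1) ^ (2 * b + 1) = 2 * p ^ a"
  shows "(2 * int b + 1) * 2 ^ b < p"
proof -
  have "2 * (2 * int b + 1) * (2 * k) ^ (2 * b) \<le> 2 * p ^ a"
    using odd_power_diff_and_sum_ge[of "2 * k" b] assms(1) eq by simp
  then have 1: "(2 * int b + 1) * (2 * k) ^ (2 * b) \<le> p ^ a" by (simp only: mult.assoc mult_le_cancel_left_pos zero_less_numeral)
  \<comment> \<open>This bounds \<open>(2 * k) ^ (2 * b)\<close> below by
    \<open>2 ^ b * p ^ b\<close>; the factor \<open>p ^ b\<close> then cancels against
    \<open>p ^ a \<le> p ^ (b + 1)\<close>.\<close>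
  have "(2 * k)\<^sup>2 = 2 * (p + 1)" by (simp add: assms(2) power2_eq_square)
  then have "(2 * k) ^ (2 * b) = 2 ^ b * (p + 1) ^ b"
    by (simp only: power_mult power_mult_distrib)
  also have "\<dots> \<ge> 2 ^ b * p ^ b"
    using assms(3) by (intro mult_left_mono power_mono) auto
  finally have "(2 * int b + 1) * (2 ^ b * p ^ b) \<le> (2 * int b + 1) * (2 * k) ^ (2 * b)"
    by (intro mult_left_mono) auto
  also note 1
  also have "p ^ a \<le> p ^ (b + 1)" using assms by (intro power_increasing) auto
  finally have "((2 * int b + 1) * 2 ^ b) * p ^ b \<le> p * p ^ b" by (simp add: algebra_simps)
  then have le: "(2 * int b + 1) * 2 ^ b \<le> p" using assms(3) by simp
  \<comment> \<open>Strictness is a matter of parity: for \<open>b > 0\<close> the left side is even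
    and \<open>p\<close> is odd.\<close>
  show ?thesis
  proof (cases "b = 0")
    case True
    then show ?thesis using assms(3) by simp
  next
    case False
    then have "even ((2 * int b + 1) * 2 ^ b)" by simp
    moreover have "odd p" by (simp add: assms(2))
    ultimately show ?thesis using le by (metis order_le_less)
  qed
qed

text \<open>"Exactly one" is rendered as an equivalence between one case and the negation of the
  other, so the proof shows that the cases exclude each other and that one of them holds.\<close>

theorem theorem3p1:
  fixes p x y z :: nat
  assumes "prime p" and "odd p"
    and "x > 0" and "y > 0" and "z > 0"
    and "\<bar>int x - int y\<bar> = 1"
    and "p ^ x + (2 * p + 1) ^ y = z\<^sup>2"
  shows "(x = 2 \<and> y = 1 \<and> z = p + 1) \<longleftrightarrow>
    \<not> (composite (2 * p + 1) \<and>
       (\<exists>(k :: int) (a :: nat) (b :: nat).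
          k \<ge> 2 \<and> a \<ge> 1 \<and> b \<ge> 0 \<and>
          x = 2 * a \<and> y = 2 * b + 1 \<and>
          int p = 2 * k\<^sup>2 - 1 \<and>
          2 * int p + 1 = (2 * k - 1) * (2 * k + 1) \<and>
          gcd (2 * k - 1) (2 * k + 1) = 1 \<and>
          (2 * k + 1) ^ (2 * b + 1) - (2 * k - 1) ^ (2 * b + 1) = 2 * (2 * k\<^sup>2 - 1) ^ a \<and>
          (2 * int b + 1) * 2 ^ b < 2 * k\<^sup>2 - 1 \<and>
          int b < \<lceil>log 2 (real_of_int (2 * k\<^sup>2 - 1))\<rceil>))" (is "_ \<longleftrightarrow> \<not> ?Q")
proof -
  have p: "prime p" "odd p" by fact+
  have "p > 1" using p(1) by (rule prime_gt_1_nat)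
  \<comment> \<open>With \<open>a = 1\<close> and \<open>b = 0\<close> the power identity reads
    \<open>2 = 2 * (2 * k\<^sup>2 - 1)\<close>, contrary to \<open>k \<ge> 2\<close>.\<close>
  have not_both: "\<not> ?Q" if "x = 2" "y = 1"
  proof
    assume ?Q
    then obtain k :: int and a b :: nat where k: "k \<ge> 2" "x = 2 * a" "y = 2 * b + 1"
      "(2 * k + 1) ^ (2 * b + 1) - (2 * k - 1) ^ (2 * b + 1) = 2 * (2 * k\<^sup>2 - 1) ^ a"
      by blast
    with that(1,2) have "a = 1" "b = 0" by simp_all
    with k have "k\<^sup>2 = 1" by simp
    with \<open>k \<ge> 2\<close> show False by (auto simp: power2_eq_1_iff)
  qed
  have one: "(x = 2 \<and> y = 1 \<and> z = p + 1) \<or> ?Q"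
  proof (cases "even x")
    case False
    then have "even y" using assms(6) by presburger
    then obtain b where b: "y = 2 * b" by (rule evenE)
    have False
      using no_solution_y_even[OF p False, of b z] assms(4,7) by (simp add: b)
    then show ?thesis ..
  next
    case True
    then obtain a where a: "x = 2 * a" by (rule evenE)
    have "odd y" using True assms(6) by presburger
    then obtain b where b: "y = 2 * b + 1" by (rule oddE)
    \<comment> \<open>Since \<open>x\<close> and \<open>y\<close> differ by 1, \<open>a\<close> is
      \<open>b\<close> or \<open>b + 1\<close>.\<close>
    have ab: "a \<ge> 1" "a \<le> b + 1" using assms(3,6) a b by linarith+
    have eq: "p ^ (2 * a) + (2 * p + 1) ^ (2 * b + 1) = z\<^sup>2"
      using assms(7) by (simp only: a b)
    show ?thesis
    proof (rule solution_x_even[OF p ab eq])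
      assume "a = 1" "b = 0" "z = p + 1"
      then show ?thesis by (simp add: a b)
    next
      fix k :: nat
      assume k: "k \<ge> 2" "p + 1 = 2 * k\<^sup>2"
        and e: "(2 * k + 1) ^ (2 * b + 1) = (2 * k - 1) ^ (2 * b + 1) + 2 * p ^ a"
      have "int p + 1 = 2 * (int k)\<^sup>2"
        using arg_cong[OF k(2), of int] by simp
      then have pk: "int p = 2 * (int k)\<^sup>2 - 1" by linarith
      have "int (2 * k - 1) = 2 * int k - 1" using k(1) by simp
      then have ei: "(2 * int k + 1) ^ (2 * b + 1) - (2 * int k - 1) ^ (2 * b + 1) = 2 * int p ^ a"
        using arg_cong[OF e, of int]
        by (simp only: of_nat_add of_nat_mult of_nat_power of_nat_numeral of_nat_1 add_diff_cancel_left')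
      have bound: "(2 * int b + 1) * 2 ^ b < int p"
        by (rule exponent_bound [OF _ pk _ ab(2) ei]) (use k(1) \<open>p > 1\<close> in simp_all)
      \<comment> \<open>Dropping the factor \<open>2 * b + 1\<close> leaves
        \<open>2 ^ b < p\<close>, and taking logarithms gives the bound on \<open>b\<close>.\<close>
      have "2 ^ b \<le> (2 * int b + 1) * 2 ^ b" by simp
      with bound have "2 ^ b < int p" by linarith
      then have "int (2 ^ b) < int p" by (simp only: of_nat_power of_nat_numeral)
      then have "real (2 ^ b) < real p" by (simp only: of_nat_less_iff)
      then have "2 ^ b < real p" by (simp only: of_nat_power of_nat_numeral)
      then have "real b < log 2 (real p)"
        by (rule less_log_of_power) simp
      then have "int b < \<lceil>log 2 (real p)\<rceil>"
        by (simp only: less_ceiling_iff of_int_of_nat_eq)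
      moreover have "real p = real_of_int (2 * (int k)\<^sup>2 - 1)"
        using arg_cong [OF pk, of real_of_int] by (simp only: of_int_of_nat_eq)
      ultimately have log: "int b < \<lceil>log 2 (real_of_int (2 * (int k)\<^sup>2 - 1))\<rceil>" by (simp only:)
      have fac: "2 * int p + 1 = (2 * int k - 1) * (2 * int k + 1)"
        by (simp add: pk power2_eq_square algebra_simps)
      \<comment> \<open>Both factors exceed 1 because \<open>k \<ge> 2\<close>.\<close>
      have "composite (2 * p + 1)"
      proof -
        have "2 * p + 1 = (2 * k - 1) * (2 * k + 1)"
          using fac \<open>int (2 * k - 1) = _\<close>
          by (simp only: of_nat_mult of_nat_add of_nat_numeral of_nat_1 flip: of_nat_eq_iff [where 'a = int])
        then have "\<not> prime (2 * p + 1)"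
          using k(1) prime_product[of "2 * k - 1" "2 * k + 1"] by auto
        then show ?thesis using \<open>p > 1\<close> by (simp add: composite_def)
      qed
      have "gcd (2 * int k - 1) (2 * int k + 1) = 1"
      proof -
        have "gcd (2 * int k - 1) (2 * int k + 1) = gcd (2 * int k - 1) ((2 * int k - 1) + 2)"
          by (simp add: algebra_simps)
        also have "\<dots> = gcd (2 * int k - 1) 2" by (rule gcd_add2)
        also have "\<dots> = 1" by (simp flip: coprime_iff_gcd_eq_1 add: coprime_right_2_iff_odd)
        finally show ?thesis .
      qed
      have "int k \<ge> 2" using k(1) by simp
      have "(2 * int k + 1) ^ (2 * b + 1) - (2 * int k - 1) ^ (2 * b + 1)
          = 2 * (2 * (int k)\<^sup>2 - 1) ^ a"
        using ei by (simp only: pk)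
      have "(2 * int b + 1) * 2 ^ b < 2 * (int k)\<^sup>2 - 1"
        using bound by (simp only: pk)
      have ?Q
        by (intro conjI, fact, rule exI [of _ "int k"], rule exI [of _ a], rule exI [of _ b], intro conjI)
          (fact a b ab(1) pk fac log | fact | rule le0)+
      then show ?thesis ..
    qed
  qed
  show ?thesis
  proof
    assume "x = 2 \<and> y = 1 \<and> z = p + 1"
    then show "\<not> ?Q" by (elim conjE) (rule not_both)
  next
    assume "\<not> ?Q"
    from one show "x = 2 \<and> y = 1 \<and> z = p + 1"
      by (rule disjE) (assumption, rule notE [OF \<open>\<not> ?Q\<close>])
  qed
qed

end
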